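(* Let $\mu\in(1,2)$ and $n\ge1$. Let $Z_0,Z_1,\dots,Z_n$ be the Markov chain on $Q_n$ with $Z_0=q_0$ and transition probabilities $p$ as defined in the context, and define bits $B'_i$ ($i=1,\dots,n$) by $B'_i=0$ if $Z_i=\delta(Z_{i-1},0)$ and $B'_i=1$ if $Z_i=\delta(Z_{i-1},1)$. Then the random bit string $B'_1\cdots B'_n$ has distribution $\mathcal{D}_n$.
   Context: Fix $\mu\in(1,2)$. The tent map is $f(x)=\mu x$ for $x\le1/2$, $f(x)=\mu(1-x)$ for $x\ge1/2$ on $[0,1]$; $f^n$ is its $n$-fold iterate, $x_i=f^i(x)$. The tent code $\gamma^n(x)=b_1\cdots b_n$ of $x\in[0,1)$: $b_1=0$ if $x<1/2$, $b_1=1$ if $x\ge1/2$; for $i\ge1$, $b_{i+1}=b_i$ if $x_i<1/2$, $b_{i+1}=1-b_i$ if $x_i>1/2$, $b_{i+1}=1$ if $x_i=1/2$. $\mathcal{L}_n=\{\gamma^n(x):x\in[0,1)\}$, and $\mathcal{D}_n$ is the law of $\gamma^n(X)$ for $X$ uniform on $[0,1)$. For $\mathbf{b}\in\mathcal{L}_n$, $S_n(\mathbf{b})=\{x\in[0,1):\gamma^n(x)=\mathbf{b}\}$, the segment-type $T(\mathbf{b})=\{f^n(x):x\in S_n(\mathbf{b})\}$, and $\mathcal{T}_n=\{T(\mathbf{b}):\mathbf{b}\in\mathcal{L}_n\}$. Let $\mathbf{c}_i=\gamma^i(1/2)$, $I_i=T(\mathbf{c}_i)$, $\overline{I}_i=T(\overline{\mathbf{c}_i})$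 ($\overline{\cdot}$ = bitwise complement). State space: $Q_n=\{q_0,\emptyset\}\cup\mathcal{T}_n$. Transition function: $\delta(q_0,1)=I_1$, $\delta(q_0,0)=\overline{I}_1$; for an interval $J$ with $v=\inf J<u=\sup J$: if $J=[v,u)$: when $v<1/2<u$, $\delta(J,0)=[f(v),f(1/2))$, $\delta(J,1)=(f(u),f(1/2)]$; when $u\le1/2$, $\delta(J,0)=[f(v),f(u))$, $\delta(J,1)=\emptyset$; when $v\ge1/2$, $\delta(J,1)=(f(u),f(v)]$, $\delta(J,0)=\emptyset$. If $J=(v,u]$: when $v<1/2<u$, $\delta(J,1)=(f(v),f(1/2)]$, $\delta(J,0)=[f(u),f(1/2))$; when $u\le1/2$, $\delta(J,1)=(f(v),f(u)]$, $\delta(J,0)=\emptyset$; when $v\ge1/2$, $\delta(J,0)=[f(u),f(v))$, $\delta(J,1)=\emptyset$. Transition probabilities: $p(q_0,I_1)=p(q_0,\overline{I}_1)=1/2$; for $J\in\mathcal{T}_{n-1}$ and $b\in\{0,1\}$ with $\delta(J,b)\ne\emptyset$, $p(J,\delta(J,b))=|\delta(J,b)|/(|\delta(J,0)|+|\delta(J,1)|)$ where $|\cdot|$ is interval length and $|\emptyset|=0$; all other transition probabilities are $0$. *)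

theory Defs
  imports "HOL-Probability.Probability"
begin

text \<open>Bits are Booleans: \<open>False\<close> is 0 and \<open>True\<close> is 1; bit strings are lists of Booleans.\<close>

definition tent :: "real \<Rightarrow> real \<Rightarrow> real" where
  "tent \<mu> x = (if x \<le> 1/2 then \<mu> * x else \<mu> * (1 - x))"

text \<open>\<open>code_bit \<mu> x i\<close> is the bit usually written \<open>b\<^sub>i\<^sub>+\<^sub>1\<close>.\<close>

primrec code_bit :: "real \<Rightarrow> real \<Rightarrow> nat \<Rightarrow> bool" where
  "code_bit \<mu> x 0 = (if x < 1/2 then False else True)"
| "code_bit \<mu> x (Suc i) =
    (let y = (tent \<mu> ^^ Suc i) x in
       if y < 1/2 then code_bit \<mu> x i
       else if y > 1/2 then \<not> code_bit \<mu> x i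
       else True)"

definition tent_code :: "real \<Rightarrow> nat \<Rightarrow> real \<Rightarrow> bool list" where
  "tent_code \<mu> n x = map (code_bit \<mu> x) [0..<n]"

definition tent_lang :: "real \<Rightarrow> nat \<Rightarrow> bool list set" where
  "tent_lang \<mu> n = tent_code \<mu> n ` {0..<1}"

definition tent_law :: "real \<Rightarrow> nat \<Rightarrow> bool list measure" where
  "tent_law \<mu> n =
    distr (uniform_measure lborel {0..<1}) (count_space UNIV) (tent_code \<mu> n)"

definition segment :: "real \<Rightarrow> bool list \<Rightarrow> real set" where
  "segment \<mu> b = {x \<in> {0..<1}. tent_code \<mu> (length b) x = b}"

definition seg_type :: "real \<Rightarrow> bool list \<Rightarrow> real set" where
  "seg_type \<mu> b = (tent \<mu> ^^ length b) ` segment \<mu> b"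

definition seg_types :: "real \<Rightarrow> nat \<Rightarrow> real set set" where
  "seg_types \<mu> n = seg_type \<mu> ` tent_lang \<mu> n"

definition crit_code :: "real \<Rightarrow> nat \<Rightarrow> bool list" where
  "crit_code \<mu> i = tent_code \<mu> i (1/2)"

definition crit_type :: "real \<Rightarrow> nat \<Rightarrow> real set" where
  "crit_type \<mu> i = seg_type \<mu> (crit_code \<mu> i)"

definition crit_type_compl :: "real \<Rightarrow> nat \<Rightarrow> real set" where
  "crit_type_compl \<mu> i = seg_type \<mu> (map Not (crit_code \<mu> i))"

text \<open>\<open>Start\<close> is the initial state \<open>q\<^sub>0\<close>; the state \<open>\<emptyset>\<close> is \<open>Seg {}\<close>.\<close>

datatype state = Start | Seg "real set"

definition states :: "real \<Rightarrow> nat \<Rightarrow> state set" where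
  "states \<mu> n = {Start, Seg {}} \<union> Seg ` seg_types \<mu> n"

text \<open>Sets that are not non-degenerate half-open intervals, in particular \<open>{}\<close>, are sent
  to \<open>{}\<close>; the chain below moves out of such a set with probability 0.\<close>

definition seg_step :: "real \<Rightarrow> real set \<Rightarrow> bool \<Rightarrow> real set" where
  "seg_step \<mu> J b =
    (let v = Inf J; u = Sup J; f = tent \<mu> in
     if v < u \<and> J = {v..<u} then
       (if v < 1/2 \<and> 1/2 < u then (if b then {f u<..f (1/2)} else {f v..<f (1/2)})
        else if u \<le> 1/2 then (if b then {} else {f v..<f u})
        else (if b then {f u<..f v} else {}))
     else if v < u \<and> J = {v<..u} then
       (if v < 1/2 \<and> 1/2 < u then (if b then {f v<..f (1/2)} else {f u..<f (1/2)})
        else if u \<le> 1/2 then (if b then {f v<..f u} else {})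
        else (if b then {} else {f u..<f v}))
     else {})"

fun delta :: "real \<Rightarrow> state \<Rightarrow> bool \<Rightarrow> state" where
  "delta \<mu> Start b = Seg (if b then crit_type \<mu> 1 else crit_type_compl \<mu> 1)"
| "delta \<mu> (Seg J) b = Seg (seg_step \<mu> J b)"

fun trans_prob :: "real \<Rightarrow> nat \<Rightarrow> state \<Rightarrow> state \<Rightarrow> real" where
  "trans_prob \<mu> n (Seg J) (Seg K) =
    (if J \<in> seg_types \<mu> (n - 1) \<and> K \<noteq> {} \<and> (\<exists>b. K = seg_step \<mu> J b)
     then measure lborel K /
       (measure lborel (seg_step \<mu> J False) + measure lborel (seg_step \<mu> J True))
     else 0)"
| "trans_prob \<mu> n Start (Seg K) =
    (if K = crit_type \<mu> 1 \<or> K = crit_type_compl \<mu> 1 then 1/2 else 0)"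
| "trans_prob \<mu> n _ Start = 0"

text \<open>A Markov chain \<open>Z 0, \<dots>, Z n\<close> on the state space \<open>Q\<close> with initial state \<open>s0\<close> and
  transition probabilities \<open>p\<close>. Conditioning is only on histories of positive probability,
  so \<open>p\<close> need not be stochastic at states that are not left within the \<open>n\<close> steps.\<close>

definition markov_chain ::
    "'w measure \<Rightarrow> nat \<Rightarrow> 's set \<Rightarrow> 's \<Rightarrow> ('s \<Rightarrow> 's \<Rightarrow> real) \<Rightarrow> (nat \<Rightarrow> 'w \<Rightarrow> 's) \<Rightarrow> bool" where
  "markov_chain M n Q s0 p Z \<longleftrightarrow>
    prob_space M \<and>
    (\<forall>i\<le>n. Z i \<in> measurable M (count_space Q)) \<and>
    (AE \<omega> in M. Z 0 \<omega> = s0) \<and>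
    (\<forall>i<n. \<forall>s. (\<forall>k\<le>Suc i. s k \<in> Q) \<longrightarrow>
       measure M {\<omega> \<in> space M. \<forall>k\<le>i. Z k \<omega> = s k} > 0 \<longrightarrow>
       cond_prob M (\<lambda>\<omega>. Z (Suc i) \<omega> = s (Suc i)) (\<lambda>\<omega>. \<forall>k\<le>i. Z k \<omega> = s k)
         = p (s i) (s (Suc i)))"

definition step_bit :: "real \<Rightarrow> state \<Rightarrow> state \<Rightarrow> bool" where
  "step_bit \<mu> q r =
    (if r = delta \<mu> q False then False
     else if r = delta \<mu> q True then True
     else undefined)"

definition output_bits :: "real \<Rightarrow> nat \<Rightarrow> (nat \<Rightarrow> 'w \<Rightarrow> state) \<Rightarrow> 'w \<Rightarrow> bool list" where
  "output_bits \<mu> n Z \<omega> = map (\<lambda>i. step_bit \<mu> (Z (i - 1) \<omega>) (Z i \<omega>)) [1..<Suc n]"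

end

theory Submission
  imports Defs
begin

text \<open>
  The tent code is monotone in \<open>x\<close>: extending a code by one bit cuts its segment at a single
  threshold, with bit 0 to the left. Hence every segment is a half-open interval, on which the
  \<open>n\<close>-fold iterate is affine of slope \<open>\<plusminus>\<mu>\<^sup>n\<close>. Segment-types
  are therefore rescaled segments, and \<open>p\<close> is the conditional probability that the code of a uniform
  point extends by a given bit, so the chain follows the path of states of \<open>b\<close> with probability
  equal to the length of the segment of \<open>b\<close>. As that path outputs \<open>b\<close>, the law of the output
  dominates the law of the code on every string; both have total mass 1, so they agree.
\<close>

text \<open>The last bit of a code is the sign of the slope of the iterate on its segment.\<close>

definition falling :: "bool list \<Rightarrow> bool" where
  "falling b \<longleftrightarrow> b \<noteq> [] \<and> last b"

lemma falling_Nil [simp]: "\<not> falling []"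
  and falling_snoc [simp]: "falling (b @ [d]) = d"
  by (auto simp: falling_def)

section \<open>Codes and their segments\<close>

lemma length_tent_code [simp]: "length (tent_code \<mu> n x) = n"
  by (simp add: tent_code_def)

lemma tent_code_Suc: "tent_code \<mu> (Suc n) x = tent_code \<mu> n x @ [code_bit \<mu> x n]"
  by (simp add: tent_code_def)

text \<open>The value 1/2 always yields bit 1, so both comparisons are weak; the previous bit only
  selects the side of 1/2. The empty code counts as not falling, which covers the first bit.\<close>

lemma code_bit_falling:
  "code_bit \<mu> x n \<longleftrightarrow>
    (if falling (tent_code \<mu> n x) then (tent \<mu> ^^ n) x \<le> 1/2 else (tent \<mu> ^^ n) x \<ge> 1/2)"
  by (cases n) (auto simp: tent_code_Suc Let_def tent_code_def not_less)

lemma segment_Nil: "segment \<mu> [] = {0..<1}"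
  by (auto simp: segment_def tent_code_def)

lemma segment_snoc:
  "segment \<mu> (b @ [d]) = {x \<in> segment \<mu> b.
     d = (if falling b then (tent \<mu> ^^ length b) x \<le> 1/2 else (tent \<mu> ^^ length b) x \<ge> 1/2)}"
  by (auto simp: segment_def tent_code_Suc code_bit_falling)

lemma seg_type_empty_iff: "seg_type \<mu> b = {} \<longleftrightarrow> segment \<mu> b = {}"
  by (simp add: seg_type_def)

text \<open>For either sign of the slope, bit 1 takes the part to the right of the threshold,
  threshold included, so every cut keeps the form \<open>{l..<r}\<close>. The slope changes sign
  exactly when the new bit differs from \<open>falling b\<close>.\<close>

lemma segment_affine:
  assumes "0 < \<mu>"
  shows "\<exists>l r \<alpha>. segment \<mu> b = {l..<r} \<and> (\<forall>x\<in>segment \<mu> b.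
    (tent \<mu> ^^ length b) x = \<alpha> + (if falling b then - (\<mu> ^ length b) else \<mu> ^ length b) * x)"
proof (induction b rule: rev_induct)
  case Nil
  show ?case
    by (rule exI[of _ 0], rule exI[of _ 1], rule exI[of _ 0]) (simp add: segment_Nil)
next
  case (snoc d b)
  define m where "m = \<mu> ^ length b"
  have m: "m > 0" using assms by (simp add: m_def)
  from snoc obtain l r \<alpha> where S: "segment \<mu> b = {l..<r}" and
    f: "\<And>x. x \<in> segment \<mu> b \<Longrightarrow>
      (tent \<mu> ^^ length b) x = \<alpha> + (if falling b then - m else m) * x"
    unfolding m_def by blast
  \<comment> \<open>The solution of "affine form = 1/2". It may lie outside the segment, hence
    \<open>max\<close> and \<open>min\<close> below.\<close>
  define t where "t = (if falling b then (\<alpha> - 1/2) / m else (1/2 - \<alpha>) / m)"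
  have S': "segment \<mu> (b @ [d]) = {x \<in> segment \<mu> b. d = (t \<le> x)}"
    unfolding segment_snoc using m
    by (intro Collect_cong conj_cong refl) (simp add: f t_def field_simps)
  have "segment \<mu> (b @ [d]) = (if d then {max l t..<r} else {l..<min r t})"
    unfolding S' S by auto
  moreover have "(tent \<mu> ^^ length (b @ [d])) x =
      (if falling b = d then \<mu> * \<alpha> else \<mu> * (1 - \<alpha>))
        + (if falling (b @ [d]) then - (\<mu> ^ length (b @ [d])) else \<mu> ^ length (b @ [d])) * x"
    if x: "x \<in> segment \<mu> (b @ [d])" for x
  proof -
    have xb: "x \<in> segment \<mu> b"
      and d: "d = (if falling b then (tent \<mu> ^^ length b) x \<le> 1/2
                   else (tent \<mu> ^^ length b) x \<ge> 1/2)"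
      using x by (auto simp: segment_snoc)
    \<comment> \<open>\<open>falling b = d\<close> says that \<open>y\<close> is on the rising
      branch. The branches agree at 1/2, so that point may be counted with either.\<close>
    have "tent \<mu> y = (if falling b = d then \<mu> * y else \<mu> * (1 - y))"
      if "d = (if falling b then y \<le> 1/2 else y \<ge> 1/2)" for y
      using that by (auto simp: tent_def split: if_splits)
    from this[OF d] f[OF xb] show ?thesis
      by (auto simp: m_def algebra_simps)
  qed
  ultimately show ?case by (cases d) auto
qed

lemma segment_borel: "0 < \<mu> \<Longrightarrow> segment \<mu> b \<in> sets lborel"
  using segment_affine[of \<mu> b] by auto

section \<open>Segment-types as intervals, and their lengths\<close>

text \<open>A negative slope reverses \<open>{l..<r}\<close>, so the last bit alone decides which
  end of the type is open.\<close>

lemma seg_type_interval: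
  assumes "0 < \<mu>" and "segment \<mu> b \<noteq> {}"
  shows "\<exists>v u. v < u \<and> seg_type \<mu> b = (if falling b then {v<..u} else {v..<u}) \<and>
    u - v = \<mu> ^ length b * measure lborel (segment \<mu> b)"
proof -
  define m where "m = \<mu> ^ length b"
  have m: "m > 0" using assms by (simp add: m_def)
  obtain l r \<alpha> where S: "segment \<mu> b = {l..<r}" and
    f: "\<And>x. x \<in> segment \<mu> b \<Longrightarrow>
      (tent \<mu> ^^ length b) x = \<alpha> + (if falling b then - m else m) * x"
    using segment_affine[OF assms(1), of b] unfolding m_def by blast
  have lr: "l < r" using assms S by auto
  have T: "seg_type \<mu> b = (\<lambda>x. \<alpha> + (if falling b then - m else m) * x) ` {l..<r}"
    unfolding seg_type_def using f S by auto
  have inv: "y \<in> (\<lambda>x. \<alpha> + k * x) ` {l..<r} \<longleftrightarrow> (y - \<alpha>) / k \<in> {l..<r}" if "k \<noteq> 0" for y k :: real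
    using that by (auto simp: image_iff intro!: bexI[of _ "(y - \<alpha>) / k"])
  show ?thesis
  proof (cases "falling b")
    case True
    have "seg_type \<mu> b = {\<alpha> - m * r<..\<alpha> - m * l}"
      using True m inv[of "- m"] by (auto simp: T field_simps)
    then show ?thesis
      using True lr m S by (intro exI[of _ "\<alpha> - m * r"] exI[of _ "\<alpha> - m * l"])
        (simp add: m_def algebra_simps)
  next
    case False
    have "seg_type \<mu> b = {\<alpha> + m * l..<\<alpha> + m * r}"
      using False m inv[of m] by (auto simp: T field_simps)
    then show ?thesis
      using False lr m S by (intro exI[of _ "\<alpha> + m * l"] exI[of _ "\<alpha> + m * r"])
        (simp add: m_def algebra_simps)
  qed
qed

text \<open>Both sides vanish for an empty segment, so the formula applies to both one-bit
  extensions of a code, whether or not they occur.\<close>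

lemma measure_seg_type:
  assumes "0 < \<mu>"
  shows "measure lborel (seg_type \<mu> b) = \<mu> ^ length b * measure lborel (segment \<mu> b)"
proof (cases "segment \<mu> b = {}")
  case True
  then show ?thesis by (simp add: seg_type_def)
next
  case False
  from seg_type_interval[OF assms this] show ?thesis by (auto split: if_splits)
qed

lemma measure_segment_pos:
  assumes "0 < \<mu>" and "segment \<mu> b \<noteq> {}"
  shows "0 < measure lborel (segment \<mu> b)"
  using segment_affine[OF assms(1), of b] assms(2) by auto

text \<open>Evaluates the denominator of \<open>trans_prob\<close>, up to a power of \<mu>.\<close>

lemma measure_segment_split:
  assumes "0 < \<mu>"
  shows "measure lborel (segment \<mu> b) =
    measure lborel (segment \<mu> (b @ [False])) + measure lborel (segment \<mu> (b @ [True]))"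
proof -
  have "segment \<mu> b = segment \<mu> (b @ [False]) \<union> segment \<mu> (b @ [True])"
    and "segment \<mu> (b @ [False]) \<inter> segment \<mu> (b @ [True]) = {}"
    by (auto simp: segment_snoc)
  moreover have "emeasure lborel (segment \<mu> b) \<noteq> \<infinity>" for b
    using segment_affine[OF assms, of b] emeasure_bounded_finite[OF bounded_Ico]
    by (metis infinity_ennreal_def less_irrefl)
  ultimately show ?thesis
    using segment_borel[OF assms] by (metis measure_Union)
qed

section \<open>The transition function as the tent map cut at 1/2\<close>

text \<open>On each side of 1/2 the map is affine and injective. Testing membership at
  \<open>\<mu> * z\<close> keeps divisions out of the interval comparisons below.\<close>

lemma tent_image:
  assumes "0 < \<mu>"
  shows "B \<subseteq> {..1/2} \<Longrightarrow> \<mu> * z \<in> tent \<mu> ` B \<longleftrightarrow> z \<in> B"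
    and "B \<subseteq> {1/2..} \<Longrightarrow> \<mu> * z \<in> tent \<mu> ` B \<longleftrightarrow> 1 - z \<in> B"
proof -
  assume "B \<subseteq> {..1/2}"
  then have "tent \<mu> ` B = (\<lambda>x. \<mu> * x) ` B"
    by (intro image_cong) (auto simp: tent_def)
  then show "\<mu> * z \<in> tent \<mu> ` B \<longleftrightarrow> z \<in> B"
    using assms by auto
next
  assume "B \<subseteq> {1/2..}"
  then have "tent \<mu> ` B = (\<lambda>x. \<mu> * (1 - x)) ` B"
    by (intro image_cong) (auto simp: tent_def)
  then show "\<mu> * z \<in> tent \<mu> ` B \<longleftrightarrow> 1 - z \<in> B"
    using assms by (auto simp: image_iff intro!: bexI[of _ "1 - z"])
qed

lemma scaled_set_eqI:
  fixes \<mu> :: real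
  assumes "0 < \<mu>" and "\<And>z. \<mu> * z \<in> A \<longleftrightarrow> \<mu> * z \<in> B"
  shows "A = B"
proof (rule set_eqI)
  fix y
  show "y \<in> A \<longleftrightarrow> y \<in> B" using assms(1) assms(2)[of "y / \<mu>"] by simp
qed

text \<open>If the sets were equal, the minimum \<open>v'\<close> of the right one would lie in the
  left one, and so would the midpoint of \<open>v\<close> and \<open>v'\<close>, which is below
  \<open>v'\<close>.\<close>

lemma half_open_neq:
  fixes v u v' u' :: real
  assumes "v < u"
  shows "{v<..u} \<noteq> {v'..<u'}"
proof
  assume eq: "{v<..u} = {v'..<u'}"
  then have "v' < u'" using assms by (metis atLeastLessThan_empty_iff greaterThanAtMost_empty_iff)
  with eq have "v' \<in> {v<..u}" by simp
  moreover have "u \<in> {v'..<u'}" using eq assms by auto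
  ultimately have "(v + v') / 2 \<in> {v<..u}" "(v + v') / 2 \<notin> {v'..<u'}" by auto
  with eq show False by simp
qed

text \<open>The three cases of \<open>seg_step\<close> describe one operation: keep the part of the
  interval on the side of 1/2 chosen by the bit and map it forward. A missing side gives the empty
  set.\<close>

lemma seg_step_rising:
  assumes mu: "0 < \<mu>" and vu: "v < u"
  shows "seg_step \<mu> {v..<u} d = tent \<mu> ` {y \<in> {v..<u}. d = (1/2 \<le> y)}"
proof (rule scaled_set_eqI[OF mu])
  fix z
  have [simp]: "Inf {v..<u} = v" "Sup {v..<u} = u" using vu by auto
  have image: "\<mu> * z \<in> tent \<mu> ` {y \<in> {v..<u}. d = (1/2 \<le> y)} \<longleftrightarrow>
      (if d then 1 - z else z) \<in> {y \<in> {v..<u}. d = (1/2 \<le> y)}"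
  proof (cases d)
    case True
    then have "{y \<in> {v..<u}. d = (1/2 \<le> y)} \<subseteq> {1/2..}" by auto
    from tent_image(2)[OF mu this, of z] True show ?thesis by simp
  next
    case False
    then have "{y \<in> {v..<u}. d = (1/2 \<le> y)} \<subseteq> {..1/2}" by auto
    from tent_image(1)[OF mu this, of z] False show ?thesis by simp
  qed
  show "\<mu> * z \<in> seg_step \<mu> {v..<u} d \<longleftrightarrow> \<mu> * z \<in> tent \<mu> ` {y \<in> {v..<u}. d = (1/2 \<le> y)}"
    unfolding image using mu vu by (cases d) (auto simp: seg_step_def Let_def tent_def)
qed

lemma seg_step_falling:
  assumes mu: "0 < \<mu>" and vu: "v < u"
  shows "seg_step \<mu> {v<..u} d = tent \<mu> ` {y \<in> {v<..u}. d = (y \<le> 1/2)}"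
proof (rule scaled_set_eqI[OF mu])
  fix z
  have [simp]: "Inf {v<..u} = v" "Sup {v<..u} = u" using vu by auto
  have [simp]: "{v<..u} \<noteq> {v..<u}" using half_open_neq[OF vu] .
  have image: "\<mu> * z \<in> tent \<mu> ` {y \<in> {v<..u}. d = (y \<le> 1/2)} \<longleftrightarrow>
      (if d then z else 1 - z) \<in> {y \<in> {v<..u}. d = (y \<le> 1/2)}"
  proof (cases d)
    case True
    then have "{y \<in> {v<..u}. d = (y \<le> 1/2)} \<subseteq> {..1/2}" by auto
    from tent_image(1)[OF mu this, of z] True show ?thesis by simp
  next
    case False
    then have "{y \<in> {v<..u}. d = (y \<le> 1/2)} \<subseteq> {1/2..}" by auto
    from tent_image(2)[OF mu this, of z] False show ?thesis by simp
  qed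
  show "\<mu> * z \<in> seg_step \<mu> {v<..u} d \<longleftrightarrow> \<mu> * z \<in> tent \<mu> ` {y \<in> {v<..u}. d = (y \<le> 1/2)}"
    unfolding image using mu vu by (cases d) (auto simp: seg_step_def Let_def tent_def)
qed

text \<open>The new bit depends on a point only through its current iterate and the last bit, and
  the shape of the type reveals the last bit. Hence the type of an extension is determined by the
  type alone, which makes types usable as states.\<close>

lemma seg_type_snoc:
  assumes "0 < \<mu>"
  shows "seg_type \<mu> (b @ [d]) = seg_step \<mu> (seg_type \<mu> b) d"
proof -
  have image: "seg_type \<mu> (b @ [d]) = tent \<mu> ` {y \<in> seg_type \<mu> b.
      d = (if falling b then y \<le> 1/2 else 1/2 \<le> y)}"
    unfolding seg_type_def segment_snoc by (auto simp: image_iff)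
  show ?thesis
  proof (cases "segment \<mu> b = {}")
    case True
    then have "seg_type \<mu> b = {}" by (simp add: seg_type_def)
    then show ?thesis unfolding image by (auto simp: seg_step_def Let_def)
  next
    case False
    from seg_type_interval[OF assms this] obtain v u where
      "v < u" "seg_type \<mu> b = (if falling b then {v<..u} else {v..<u})" by blast
    then show ?thesis unfolding image
      using seg_step_rising[OF assms, of v u d] seg_step_falling[OF assms, of v u d]
      by (cases "falling b") simp_all
  qed
qed

text \<open>Bit 1 leaves a left-open type and bit 0 a right-open or empty one, so the emitted bit
  can be read off from the successor.\<close>

lemma seg_type_falling_neq:
  assumes "0 < \<mu>" and "segment \<mu> (b @ [True]) \<noteq> {}"
  shows "seg_type \<mu> (b @ [True]) \<noteq> seg_type \<mu> (b @ [False])"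
proof (cases "segment \<mu> (b @ [False]) = {}")
  case True
  then show ?thesis using assms by (metis seg_type_empty_iff)
next
  case False
  obtain v u where "v < u" "seg_type \<mu> (b @ [True]) = {v<..u}"
    using seg_type_interval[OF assms] by auto
  moreover obtain v' u' where "seg_type \<mu> (b @ [False]) = {v'..<u'}"
    using seg_type_interval[OF assms(1) False] by auto
  ultimately show ?thesis using half_open_neq by simp
qed

section \<open>The state space: finiteness and growth with the length\<close>

lemma seg_types_eq: "seg_types \<mu> n = {seg_type \<mu> b |b. length b = n \<and> segment \<mu> b \<noteq> {}}"
proof -
  have "b \<in> tent_lang \<mu> n \<longleftrightarrow> length b = n \<and> segment \<mu> b \<noteq> {}" for b
    by (auto simp: tent_lang_def segment_def intro: rev_image_eqI)
  then show ?thesis unfolding seg_types_def by blast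
qed

lemma finite_seg_types: "finite (seg_types \<mu> n)"
proof -
  have "seg_types \<mu> n \<subseteq> seg_type \<mu> ` {b. set b \<subseteq> UNIV \<and> length b = n}"
    by (auto simp: seg_types_eq)
  then show ?thesis by (rule finite_subset) (intro finite_imageI finite_lists_length_eq, simp)
qed

lemma seg_type_Nil: "seg_type \<mu> [] = {0..<1}"
  by (simp add: seg_type_def segment_Nil)

lemma seg_type_single:
  assumes "0 < \<mu>"
  shows "seg_type \<mu> [d] = (if d then {0<..\<mu>/2} else {0..<\<mu>/2})"
  using seg_type_snoc[OF assms, of "[]" d]
  by (simp add: seg_type_Nil seg_step_def tent_def)

text \<open>The ends of the one-bit types are the fixed point 0 and \<mu>/2, the image of 1/2. As
  \<mu> > 1, the interval straddles 1/2, and its own bit maps it onto itself.\<close>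

lemma seg_type_repeat:
  assumes "1 < \<mu>"
  shows "seg_type \<mu> [d, d] = seg_type \<mu> [d]"
proof -
  have "seg_type \<mu> [d, d] = seg_step \<mu> (seg_type \<mu> [d]) d"
    using seg_type_snoc[of \<mu> "[d]" d] assms by simp
  also have "\<dots> = seg_type \<mu> [d]"
    using assms half_open_neq[of 0 "\<mu>/2" 0 "\<mu>/2"]
    by (simp add: seg_type_single seg_step_def tent_def Let_def)
  finally show ?thesis .
qed

text \<open>Doubling the first bit does not change the type, and later bits act on the type
  only.\<close>

lemma seg_type_Suc_length:
  assumes "1 < \<mu>" and "b \<noteq> []"
  shows "\<exists>b'. length b' = Suc (length b) \<and> seg_type \<mu> b' = seg_type \<mu> b"
  using assms(2)
proof (induction b rule: rev_nonempty_induct)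
  case (single d)
  show ?case using seg_type_repeat[OF assms(1), of d] by (intro exI[of _ "[d, d]"]) simp
next
  case (snoc d b)
  then obtain b' where "length b' = Suc (length b)" "seg_type \<mu> b' = seg_type \<mu> b" by blast
  then show ?case using assms(1) by (intro exI[of _ "b' @ [d]"]) (simp add: seg_type_snoc)
qed

text \<open>The chain lives on the types of length exactly \<open>n\<close>; this puts its earlier states among them.\<close>

lemma seg_types_mono:
  assumes "1 < \<mu>" and "1 \<le> k" and "k \<le> n"
  shows "seg_types \<mu> k \<subseteq> seg_types \<mu> n"
  using assms(3)
proof (induction n rule: dec_induct)
  case base
  show ?case by simp
next
  case (step n)
  have "seg_types \<mu> n \<subseteq> seg_types \<mu> (Suc n)"
  proof
    fix J assume "J \<in> seg_types \<mu> n"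
    then obtain b where b: "J = seg_type \<mu> b" "length b = n" "segment \<mu> b \<noteq> {}"
      by (auto simp: seg_types_eq)
    with step assms(2) obtain b' where "length b' = Suc n" "seg_type \<mu> b' = J"
      using seg_type_Suc_length[OF assms(1), of b] by fastforce
    moreover from this b have "segment \<mu> b' \<noteq> {}"
      by (simp flip: seg_type_empty_iff)
    ultimately show "J \<in> seg_types \<mu> (Suc n)"
      unfolding seg_types_eq by blast
  qed
  with step show ?case by blast
qed

section \<open>The path of states belonging to a code\<close>

text \<open>Index 0 is separate because the chain begins in \<open>Start\<close> and not in the type
  \<open>{0..<1}\<close> of the empty code.\<close>

definition code_path :: "real \<Rightarrow> bool list \<Rightarrow> nat \<Rightarrow> state" where
  "code_path \<mu> b k = (if k = 0 then Start else Seg (seg_type \<mu> (take k b)))"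

lemma crit_type_1: "crit_type \<mu> 1 = seg_type \<mu> [True]"
  and crit_type_compl_1: "crit_type_compl \<mu> 1 = seg_type \<mu> [False]"
  by (simp_all add: crit_type_def crit_type_compl_def crit_code_def tent_code_def)

lemma segment_take:
  assumes "segment \<mu> b \<noteq> {}"
  shows "segment \<mu> (take k b) \<noteq> {}"
proof -
  have "segment \<mu> b \<subseteq> segment \<mu> (take k b)"
  proof
    fix x assume "x \<in> segment \<mu> b"
    then have "x \<in> {0..<1}" and "tent_code \<mu> (length b) x = b" by (auto simp: segment_def)
    moreover have "tent_code \<mu> (length (take k b)) x = take k (tent_code \<mu> (length b) x)"
      by (simp add: tent_code_def take_map min_def)
    ultimately show "x \<in> segment \<mu> (take k b)" by (simp add: segment_def)
  qed
  with assms show ?thesis by blast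
qed

lemma seg_type_take_in_seg_types:
  assumes "segment \<mu> b \<noteq> {}" and "k \<le> length b"
  shows "seg_type \<mu> (take k b) \<in> seg_types \<mu> k"
  unfolding seg_types_eq using segment_take[OF assms(1), of k] assms(2)
  by (intro CollectI exI[of _ "take k b"]) simp

text \<open>The step out of \<open>Start\<close> fits the general pattern because its two targets
  are the types of the one-bit codes.\<close>

lemma delta_code_path:
  assumes "0 < \<mu>" and "k < length b"
  shows "delta \<mu> (code_path \<mu> b k) d = Seg (seg_type \<mu> (take k b @ [d]))"
  using assms
  by (cases d) (simp_all add: code_path_def crit_type_1[simplified] crit_type_compl_1[simplified]
      flip: seg_type_snoc)

text \<open>\<open>step_bit\<close> tests bit 0 first, so for bit 1 the two successors must be known
  to differ.\<close>

lemma step_bit_code_path: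
  assumes "0 < \<mu>" and "k < length b" and "segment \<mu> b \<noteq> {}"
  shows "step_bit \<mu> (code_path \<mu> b k) (code_path \<mu> b (Suc k)) = b ! k"
proof -
  have "code_path \<mu> b (Suc k) = Seg (seg_type \<mu> (take k b @ [b ! k]))"
    using assms by (simp add: code_path_def take_Suc_conv_app_nth)
  moreover have "segment \<mu> (take k b @ [b ! k]) \<noteq> {}"
    using segment_take[OF assms(3), of "Suc k"] assms(2) by (simp add: take_Suc_conv_app_nth)
  ultimately show ?thesis
    using assms seg_type_falling_neq[of \<mu> "take k b"]
    by (cases "b ! k") (auto simp: step_bit_def delta_code_path)
qed

lemma code_path_states:
  assumes "1 < \<mu>" and "k \<le> n" and "length b = n" and "segment \<mu> b \<noteq> {}"
  shows "code_path \<mu> b k \<in> states \<mu> n"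
proof (cases "k = 0")
  case True
  then show ?thesis by (simp add: code_path_def states_def)
next
  case False
  have "seg_type \<mu> (take k b) \<in> seg_types \<mu> k"
    using seg_type_take_in_seg_types[OF assms(4)] assms(2,3) by simp
  with seg_types_mono[OF assms(1) _ assms(2)] False show ?thesis
    by (auto simp: code_path_def states_def)
qed

lemma trans_prob_code_path:
  assumes "1 < \<mu>" and "i < n" and "length b = n" and "segment \<mu> b \<noteq> {}"
  shows "trans_prob \<mu> n (code_path \<mu> b i) (code_path \<mu> b (Suc i)) =
    measure lborel (segment \<mu> (take (Suc i) b)) / measure lborel (segment \<mu> (take i b))"
proof -
  have mu: "0 < \<mu>" using assms by simp
  let ?c = "take i b" let ?d = "b ! i"
  have take: "take (Suc i) b = ?c @ [?d]" using assms by (simp add: take_Suc_conv_app_nth)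
  \<comment> \<open>Both extensions have the same length, so the power of \<mu> cancels.\<close>
  have ratio: "measure lborel (seg_type \<mu> (?c @ [?d])) /
      (measure lborel (seg_type \<mu> (?c @ [False])) + measure lborel (seg_type \<mu> (?c @ [True])))
    = measure lborel (segment \<mu> (?c @ [?d])) / measure lborel (segment \<mu> ?c)"
    using mu assms(2,3)
    by (simp add: measure_seg_type measure_segment_split[OF mu, of ?c] flip: distrib_left)
  show ?thesis
  proof (cases "i = 0")
    case True
    have half: "measure lborel (seg_type \<mu> [d]) = \<mu> / 2" for d
      using mu by (simp add: seg_type_single)
    \<comment> \<open>Both one-bit types have length \<mu>/2, so the ratio agrees with the
      probability 1/2 prescribed at \<open>Start\<close>.\<close>
    have "1/2 = measure lborel (segment \<mu> (take (Suc i) b)) / measure lborel (segment \<mu> (take i b))"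
      unfolding take ratio[symmetric] using True mu by (simp add: half)
    moreover have "trans_prob \<mu> n (code_path \<mu> b i) (code_path \<mu> b (Suc i)) = 1/2"
      using True unfolding code_path_def take
      by (cases "b ! 0") (simp_all add: crit_type_1[simplified] crit_type_compl_1[simplified])
    ultimately show ?thesis by simp
  next
    case False
    have "seg_type \<mu> ?c \<in> seg_types \<mu> i"
      using seg_type_take_in_seg_types[OF assms(4)] assms(2,3) by simp
    \<comment> \<open>\<open>trans_prob\<close> accepts only types of length \<open>n - 1\<close> as
      sources, so the type of the shorter prefix is lifted to that length.\<close>
    moreover have "1 \<le> i" "i \<le> n - 1" using False assms(2) by auto
    ultimately have "seg_type \<mu> ?c \<in> seg_types \<mu> (n - 1)"
      using seg_types_mono[OF assms(1), of i "n - 1"] by blast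
    moreover have "seg_type \<mu> (?c @ [?d]) \<noteq> {}"
      using segment_take[OF assms(4), of "Suc i"] unfolding take by (simp add: seg_type_empty_iff)
    ultimately show ?thesis
      using False ratio unfolding code_path_def take
      by (auto simp: seg_type_snoc[OF mu])
  qed
qed

text \<open>Multiplying the transition probabilities telescopes the ratios of segment lengths,
  starting from the length 1 of \<open>{0..<1}\<close>. Prefix segments have positive length, so
  each history may be conditioned on.\<close>

lemma prob_code_path:
  assumes chain: "markov_chain M n (states \<mu> n) Start (trans_prob \<mu> n) Z"
    and "1 < \<mu>" and "length b = n" and "segment \<mu> b \<noteq> {}" and "i \<le> n"
  shows "measure M {\<omega> \<in> space M. \<forall>k\<le>i. Z k \<omega> = code_path \<mu> b k} =
    measure lborel (segment \<mu> (take i b))"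
  using assms(5)
proof (induction i)
  case 0
  interpret prob_space M using chain by (simp add: markov_chain_def)
  have Z: "Z 0 \<in> measurable M (count_space (states \<mu> n))" and "AE \<omega> in M. Z 0 \<omega> = Start"
    using chain by (simp_all add: markov_chain_def)
  moreover have "{\<omega> \<in> space M. Z 0 \<omega> = Start} \<in> events"
    using Z by measurable
  ultimately have "prob {\<omega> \<in> space M. Z 0 \<omega> = Start} = 1"
    by (simp add: prob_Collect_eq_1)
  then show ?case by (simp add: code_path_def segment_Nil)
next
  case (Suc i)
  let ?A = "{\<omega> \<in> space M. \<forall>k\<le>i. Z k \<omega> = code_path \<mu> b k}"
  let ?A' = "{\<omega> \<in> space M. \<forall>k\<le>Suc i. Z k \<omega> = code_path \<mu> b k}"
  have IH: "measure M ?A = measure lborel (segment \<mu> (take i b))" using Suc by simp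
  also have pos: "\<dots> > 0"
    using assms segment_take by (intro measure_segment_pos) auto
  finally have A_pos: "measure M ?A > 0" .
  have "cond_prob M (\<lambda>\<omega>. Z (Suc i) \<omega> = code_path \<mu> b (Suc i))
      (\<lambda>\<omega>. \<forall>k\<le>i. Z k \<omega> = code_path \<mu> b k)
    = trans_prob \<mu> n (code_path \<mu> b i) (code_path \<mu> b (Suc i))"
    using chain A_pos Suc.prems code_path_states[OF assms(2) _ assms(3,4)]
    unfolding markov_chain_def by auto
  also have "\<dots> = measure lborel (segment \<mu> (take (Suc i) b)) / measure M ?A"
    unfolding IH using assms Suc.prems by (intro trans_prob_code_path) auto
  finally have "measure M {\<omega> \<in> space M. Z (Suc i) \<omega> = code_path \<mu> b (Suc i) \<and>
      (\<forall>k\<le>i. Z k \<omega> = code_path \<mu> b k)} = measure lborel (segment \<mu> (take (Suc i) b))"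
    using A_pos by (simp add: cond_prob_def)
  also have "{\<omega> \<in> space M. Z (Suc i) \<omega> = code_path \<mu> b (Suc i) \<and>
      (\<forall>k\<le>i. Z k \<omega> = code_path \<mu> b k)} = ?A'"
    by (auto simp: le_Suc_eq)
  finally show ?case .
qed

section \<open>Measurability of the output and comparison of the laws\<close>

lemma measurable_bool_lists:
  assumes "\<And>b. f -` {b} \<inter> space M \<in> sets M"
  shows "f \<in> measurable M (count_space (UNIV :: bool list set))"
  using assms by (intro measurable_count_space_eq_countable[THEN iffD2]) auto

lemma map_upt_eq_iff:
  "map f [0..<n] = b \<longleftrightarrow> length b = n \<and> (\<forall>i\<in>{..<n}. f i = b ! i)"
proof -
  have "map f [0..<n] = b \<longleftrightarrow> n = length b \<and> (\<forall>i<n. f i = b ! i)"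
    by (simp add: list_eq_iff_nth_eq)
  then show ?thesis by (metis lessThan_iff)
qed

lemma output_bits_eq_map:
  "output_bits \<mu> n Z \<omega> = map (\<lambda>i. step_bit \<mu> (Z i \<omega>) (Z (Suc i) \<omega>)) [0..<n]"
  by (rule nth_equalityI) (simp_all add: output_bits_def del: upt_Suc)

lemma output_bits_code_path:
  assumes "0 < \<mu>" and "length b = n" and "segment \<mu> b \<noteq> {}"
    and "\<forall>k\<le>n. Z k \<omega> = code_path \<mu> b k"
  shows "output_bits \<mu> n Z \<omega> = b"
  unfolding output_bits_eq_map map_upt_eq_iff
  using assms(2,4) step_bit_code_path[OF assms(1) _ assms(3)] by simp

lemma measurable_output_bits:
  assumes "markov_chain M n (states \<mu> n) Start (trans_prob \<mu> n) Z"
  shows "output_bits \<mu> n Z \<in> measurable M (count_space UNIV)"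
proof (rule measurable_bool_lists)
  fix b
  have Q: "countable (states \<mu> n)"
    by (simp add: states_def finite_seg_types countable_finite)
  have Z: "Z i \<in> measurable M (count_space (states \<mu> n))" if "i \<le> n" for i
    using assms that by (simp add: markov_chain_def)
  have bit: "(\<lambda>\<omega>. step_bit \<mu> (Z i \<omega>) (Z (Suc i) \<omega>)) \<in> measurable M (count_space UNIV)"
    if "i < n" for i
  \<comment> \<open>There are only countably many states, so the first argument of
    \<open>step_bit\<close> can be frozen at each value of \<open>Z i\<close>.\<close>
  proof (rule measurable_compose_countable'[OF _ _ Q, where g = "Z i"])
    show "Z i \<in> measurable M (count_space (states \<mu> n))" using Z that by simp
    show "(\<lambda>\<omega>. step_bit \<mu> q (Z (Suc i) \<omega>)) \<in> measurable M (count_space UNIV)" for q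
      by (rule measurable_compose[OF Z[of "Suc i"]]) (use that in simp_all)
  qed
  have "output_bits \<mu> n Z -` {b} \<inter> space M =
    {\<omega> \<in> space M. length b = n \<and> (\<forall>i\<in>{..<n}. step_bit \<mu> (Z i \<omega>) (Z (Suc i) \<omega>) = b ! i)}"
    unfolding output_bits_eq_map vimage_def singleton_iff map_upt_eq_iff by blast
  also have "\<dots> \<in> sets M"
  proof -
    have "Measurable.pred M (\<lambda>\<omega>. step_bit \<mu> (Z i \<omega>) (Z (Suc i) \<omega>) = b ! i)" if "i < n" for i
      using bit[OF that] by measurable
    then have "Measurable.pred M
        (\<lambda>\<omega>. \<forall>i\<in>{..<n}. step_bit \<mu> (Z i \<omega>) (Z (Suc i) \<omega>) = b ! i)"
      by (intro pred_intros_finite) auto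
    then show ?thesis by measurable
  qed
  finally show "output_bits \<mu> n Z -` {b} \<inter> space M \<in> sets M" .
qed

text \<open>On \<open>A\<close> the differences of the point masses are nonnegative, while their sum
  is at most 1 - 1 = 0, so each is 0. Both measures then live on \<open>A\<close>.\<close>

lemma measure_eqI_finite_support_le:
  fixes N N' :: "'a measure"
  assumes "prob_space N" "prob_space N'" "finite A"
    and sets: "sets N = UNIV" "sets N' = UNIV"
    and A: "measure N' A = 1"
    and le: "\<And>x. x \<in> A \<Longrightarrow> measure N' {x} \<le> measure N {x}"
  shows "N = N'"
proof -
  interpret N: prob_space N by fact
  interpret N': prob_space N' by fact
  have sums: "measure N B = (\<Sum>x\<in>B. measure N {x})" "measure N' B = (\<Sum>x\<in>B. measure N' {x})"
    if "B \<subseteq> A" for B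
    using that finite_subset[OF that assms(3)] sets
    by (auto intro!: N.finite_measure_eq_sum_singleton N'.finite_measure_eq_sum_singleton)
  have "(\<Sum>x\<in>A. measure N {x} - measure N' {x}) \<le> 0"
    using A sums[of A] N.prob_le_1[of A] by (simp add: sum_subtractf)
  moreover have "(\<Sum>x\<in>A. measure N {x} - measure N' {x}) \<ge> 0"
    using le by (intro sum_nonneg) simp
  ultimately have eq0: "(\<Sum>x\<in>A. measure N {x} - measure N' {x}) = 0" by simp
  have pt: "measure N {x} = measure N' {x}" if "x \<in> A" for x
    using sum_nonneg_0[OF assms(3) _ eq0 that] le by simp
  then have NA: "measure N A = 1" using A sums[of A] by simp
  show ?thesis
  proof (rule measure_eqI)
    fix X
    have "AE x in N. x \<in> A" "AE x in N'. x \<in> A"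
      using NA A sets by (auto intro!: N.AE_prob_1 N'.AE_prob_1)
    then have "measure N X = measure N (X \<inter> A)" "measure N' X = measure N' (X \<inter> A)"
      using sets by (auto intro!: N.finite_measure_eq_AE N'.finite_measure_eq_AE)
    then have "measure N X = measure N' X"
      using sums[of "X \<inter> A"] pt by simp
    then show "emeasure N X = emeasure N' X"
      by (simp add: N.emeasure_eq_measure N'.emeasure_eq_measure)
  qed (simp add: sets)
qed

lemma measurable_tent_code:
  assumes "0 < \<mu>"
  shows "tent_code \<mu> n \<in> measurable (uniform_measure lborel {0..<1}) (count_space UNIV)"
proof -
  have [measurable]: "tent \<mu> \<in> borel_measurable borel"
    unfolding tent_def by measurable
  have [measurable]: "(tent \<mu> ^^ i) \<in> borel_measurable borel" for i
    by (induction i) (simp_all add: measurable_comp[of _ borel])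
  have bit [measurable]: "Measurable.pred borel (\<lambda>x. code_bit \<mu> x i)" for i
    by (induction i) (simp_all add: Let_def)
  have "tent_code \<mu> n \<in> measurable borel (count_space UNIV)"
  proof (rule measurable_bool_lists)
    fix b
    have "tent_code \<mu> n -` {b} \<inter> space borel =
      {x \<in> space borel. length b = n \<and> (\<forall>i\<in>{..<n}. code_bit \<mu> x i = b ! i)}"
      unfolding tent_code_def vimage_def singleton_iff map_upt_eq_iff by blast
    also have "\<dots> \<in> sets borel" by measurable
    finally show "tent_code \<mu> n -` {b} \<inter> space borel \<in> sets borel" .
  qed
  then show ?thesis by (simp cong: measurable_cong_sets)
qed

lemma measure_tent_law:
  assumes "0 < \<mu>" and "length b = n"
  shows "measure (tent_law \<mu> n) {b} = measure lborel (segment \<mu> b)"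
proof -
  let ?U = "uniform_measure lborel {0..<1::real}"
  have "tent_code \<mu> n -` {b} \<inter> space ?U \<in> sets ?U"
    using measurable_tent_code[OF assms(1)] by (rule measurable_sets) simp
  then have "tent_code \<mu> n -` {b} \<in> sets lborel" by simp
  moreover have "{0..<1} \<inter> tent_code \<mu> n -` {b} = segment \<mu> b"
    using assms(2) by (auto simp: segment_def)
  ultimately show ?thesis
    using measurable_tent_code[OF assms(1)]
    by (simp add: tent_law_def measure_distr)
qed

theorem theorem3:
  fixes \<mu> :: real and n :: nat
    and M :: "'w measure" and Z :: "nat \<Rightarrow> 'w \<Rightarrow> state"
  assumes "1 < \<mu>" and "\<mu> < 2" and "1 \<le> n"
    and "markov_chain M n (states \<mu> n) Start (trans_prob \<mu> n) Z"
  shows "distr M (count_space UNIV) (output_bits \<mu> n Z) = tent_law \<mu> n"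
proof (rule measure_eqI_finite_support_le[where A = "{b. length b = n}"])
  have mu: "0 < \<mu>" using assms by simp
  interpret prob_space M using assms(4) by (simp add: markov_chain_def)
  interpret U: prob_space "uniform_measure lborel {0..<1::real}"
    by (rule prob_space_uniform_measure) auto
  note out = measurable_output_bits[OF assms(4)]
  note code = measurable_tent_code[OF mu]
  show "prob_space (distr M (count_space UNIV) (output_bits \<mu> n Z))"
    by (rule prob_space_distr[OF out])
  show "prob_space (tent_law \<mu> n)"
    unfolding tent_law_def by (rule U.prob_space_distr[OF code])
  show "finite {b :: bool list. length b = n}"
    using finite_lists_length_eq[of "UNIV :: bool set" n] by simp
  have "measure (tent_law \<mu> n) {b. length b = n} = U.prob (space (uniform_measure lborel {0..<1}))"
    unfolding tent_law_def by (subst measure_distr[OF code]) (auto intro!: arg_cong[where f = U.prob])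
  then show "measure (tent_law \<mu> n) {b. length b = n} = 1"
    using U.prob_space by simp
  fix b :: "bool list" assume "b \<in> {b. length b = n}"
  then have b: "length b = n" by simp
  show "measure (tent_law \<mu> n) {b} \<le> measure (distr M (count_space UNIV) (output_bits \<mu> n Z)) {b}"
  proof (cases "segment \<mu> b = {}")
    case True
    then show ?thesis using measure_tent_law[OF mu b] by simp
  next
    case False
    have "measure (tent_law \<mu> n) {b} = prob {\<omega> \<in> space M. \<forall>k\<le>n. Z k \<omega> = code_path \<mu> b k}"
      using measure_tent_law[OF mu b] prob_code_path[OF assms(4,1) b False order_refl] b by simp
    \<comment> \<open>Following the path of \<open>b\<close> forces the output \<open>b\<close>;
      this inclusion of events gives the domination.\<close>
    also have "\<dots> \<le> prob (output_bits \<mu> n Z -` {b} \<inter> space M)"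
      using output_bits_code_path[OF mu b False] measurable_sets[OF out]
      by (intro finite_measure_mono) auto
    also have "\<dots> = measure (distr M (count_space UNIV) (output_bits \<mu> n Z)) {b}"
      by (simp add: measure_distr[OF out])
    finally show ?thesis .
  qed
qed (simp_all add: tent_law_def)

end
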